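(* Let $R$ be a finite-dimensional algebra over a field $K$ and let $\psi:R^*\otimes_R R^*\to R$ be a morphism of $R$-bimodules which is associative, i.e. $\psi(r^*\otimes_R s^* )\rightharpoonup t^*=r^*\leftharpoonup\psi(s^*\otimes_R t^* )$ for all $r^*,s^*,t^*\in R^*$. Then the semitrivial extension $R\rtimes_\psi R^*$ is a symmetric algebra.
   Context: Algebras are associative and unital. For a finite-dimensional $K$-algebra $A$, the dual $A^*=\mathrm{Hom}_K(A,K)$ is an $A$-bimodule by $(r\rightharpoonup r^* )(a)=r^*(ar)$ and $(r^*\leftharpoonup r)(a)=r^*(ra)$ for $r,a\in A$, $r^*\in A^*$. $A$ is called symmetric if $A\simeq A^*$ as $A$-bimodules. For an associative bimodule morphism $\psi:R^*\otimes_RR^*\to R$, the semitrivial extension $R\rtimes_\psi R^*$ is the $K$-algebra with underlying vector space $R\times R^*$ and multiplication $(r,r^* )(s,s^* )=(rs+\psi(r^*\otimes_R s^* ),\,(r\rightharpoonup s^* )+(r^*\leftharpoonup s))$, with identity $(1,0)$. *)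

theory Defs
  imports "Jordan_Normal_Form.Missing_VectorSpace" "HOL-Algebra.Free_Abelian_Groups"
begin

text \<open>The locale \<^locale>\<open>algebra\<close> of HOL-Algebra is restricted to commutative algebras.\<close>

locale fin_dim_algebra = vectorspace K A + A?: ring A
  for K and A (structure) +
  assumes smult_mult_left:
      "\<lbrakk>k \<in> carrier K; x \<in> carrier A; y \<in> carrier A\<rbrakk> \<Longrightarrow> (k \<odot> x) \<otimes> y = k \<odot> (x \<otimes> y)"
    and smult_mult_right:
      "\<lbrakk>k \<in> carrier K; x \<in> carrier A; y \<in> carrier A\<rbrakk> \<Longrightarrow> x \<otimes> (k \<odot> y) = k \<odot> (x \<otimes> y)"
    and finite_dimensional: "fin_dim"

text \<open>
  As for \<^type>\<open>module\<close>, a bimodule extends the record of rings only to have the fields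
  \<^const>\<open>ring.zero\<close> and \<^const>\<open>ring.add\<close>; the fields \<^const>\<open>monoid.mult\<close> and
  \<^const>\<open>monoid.one\<close> carry no meaning.
\<close>

record ('a, 'm) bimodule = "'m ring" +
  lact :: "['a, 'm] \<Rightarrow> 'm" (infixr \<open>\<rightharpoonup>\<index>\<close> 70)
  ract :: "['m, 'a] \<Rightarrow> 'm" (infixl \<open>\<leftharpoonup>\<index>\<close> 70)

text \<open>
  Between bimodules that come from algebras over a field \<open>K\<close>, such maps are automatically
  \<open>K\<close>-linear, because \<open>K\<close> acts through the multiples of the unit.
\<close>

definition bimodule_hom ::
  "[('a, 'r) ring_scheme, ('a, 'm, 'x) bimodule_scheme, ('a, 'n, 'y) bimodule_scheme] \<Rightarrow> ('m \<Rightarrow> 'n) set"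
  where "bimodule_hom R M N =
    {h \<in> carrier M \<rightarrow> carrier N.
       (\<forall>m\<in>carrier M. \<forall>m'\<in>carrier M. h (m \<oplus>\<^bsub>M\<^esub> m') = h m \<oplus>\<^bsub>N\<^esub> h m') \<and>
       (\<forall>r\<in>carrier R. \<forall>m\<in>carrier M. h (r \<rightharpoonup>\<^bsub>M\<^esub> m) = r \<rightharpoonup>\<^bsub>N\<^esub> h m) \<and>
       (\<forall>r\<in>carrier R. \<forall>m\<in>carrier M. h (m \<leftharpoonup>\<^bsub>M\<^esub> r) = h m \<leftharpoonup>\<^bsub>N\<^esub> r)}"

definition bimodule_iso ::
  "[('a, 'r) ring_scheme, ('a, 'm, 'x) bimodule_scheme, ('a, 'n, 'y) bimodule_scheme] \<Rightarrow> ('m \<Rightarrow> 'n) set"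
  where "bimodule_iso R M N = {h \<in> bimodule_hom R M N. bij_betw h (carrier M) (carrier N)}"

definition regular_bimodule :: "('a, 'r) ring_scheme \<Rightarrow> ('a, 'a) bimodule"
  where "regular_bimodule R =
    \<lparr>carrier = carrier R, mult = (\<otimes>\<^bsub>R\<^esub>), one = \<one>\<^bsub>R\<^esub>, ring.zero = \<zero>\<^bsub>R\<^esub>, add = (\<oplus>\<^bsub>R\<^esub>),
     lact = (\<otimes>\<^bsub>R\<^esub>), ract = (\<otimes>\<^bsub>R\<^esub>)\<rparr>"

definition self_module :: "('k, 'c) ring_scheme \<Rightarrow> ('k, 'k) module"
  where "self_module K =
    \<lparr>carrier = carrier K, mult = (\<otimes>\<^bsub>K\<^esub>), one = \<one>\<^bsub>K\<^esub>, ring.zero = \<zero>\<^bsub>K\<^esub>, add = (\<oplus>\<^bsub>K\<^esub>),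
     smult = (\<otimes>\<^bsub>K\<^esub>)\<rparr>"

text \<open>
  Functionals are extensional, i.e. \<^const>\<open>undefined\<close> outside \<^term>\<open>carrier V\<close>, so that two
  of them are equal as soon as they agree on \<^term>\<open>carrier V\<close>.
\<close>

definition dual_space ::
  "[('k, 'c) ring_scheme, ('k, 'a, 'd) module_scheme] \<Rightarrow> ('k, 'a \<Rightarrow> 'k) module"
  where "dual_space K V =
    \<lparr>carrier = module_hom K V (self_module K) \<inter> extensional (carrier V),
     mult = undefined, one = undefined,
     ring.zero = (\<lambda>a\<in>carrier V. \<zero>\<^bsub>K\<^esub>),
     add = (\<lambda>f g. \<lambda>a\<in>carrier V. f a \<oplus>\<^bsub>K\<^esub> g a),
     smult = (\<lambda>k f. \<lambda>a\<in>carrier V. k \<otimes>\<^bsub>K\<^esub> f a)\<rparr>"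

definition dual_bimodule ::
  "[('k, 'c) ring_scheme, ('k, 'a, 'd) module_scheme] \<Rightarrow> ('a, 'a \<Rightarrow> 'k) bimodule"
  where "dual_bimodule K A =
    \<lparr>carrier = carrier (dual_space K A),
     mult = undefined, one = undefined,
     ring.zero = \<zero>\<^bsub>dual_space K A\<^esub>,
     add = (\<oplus>\<^bsub>dual_space K A\<^esub>),
     lact = (\<lambda>r f. \<lambda>a\<in>carrier A. f (a \<otimes>\<^bsub>A\<^esub> r)),
     ract = (\<lambda>f r. \<lambda>a\<in>carrier A. f (r \<otimes>\<^bsub>A\<^esub> a))\<rparr>"

definition symmetric_algebra ::
  "[('k, 'c) ring_scheme, ('k, 'a, 'd) module_scheme] \<Rightarrow> bool"
  where "symmetric_algebra K A \<longleftrightarrow>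
    fin_dim_algebra K A \<and> bimodule_iso A (regular_bimodule A) (dual_bimodule K A) \<noteq> {}"

text \<open>
  The tensor product over \<open>R\<close> is the free abelian group on the pairs \<open>(m, n)\<close> modulo the
  subgroup generated by the biadditivity and balancing relations.  Its elements are cosets.
\<close>

definition tensor_relators ::
  "[('a, 'r) ring_scheme, ('a, 'm, 'x) bimodule_scheme, ('a, 'n, 'y) bimodule_scheme]
    \<Rightarrow> ('m \<times> 'n \<Rightarrow>\<^sub>0 int) set"
  where "tensor_relators R M N =
    {frag_of (m \<oplus>\<^bsub>M\<^esub> m', n) - frag_of (m, n) - frag_of (m', n) | m m' n.
       m \<in> carrier M \<and> m' \<in> carrier M \<and> n \<in> carrier N} \<union>
    {frag_of (m, n \<oplus>\<^bsub>N\<^esub> n') - frag_of (m, n) - frag_of (m, n') | m n n'.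
       m \<in> carrier M \<and> n \<in> carrier N \<and> n' \<in> carrier N} \<union>
    {frag_of (m \<leftharpoonup>\<^bsub>M\<^esub> r, n) - frag_of (m, r \<rightharpoonup>\<^bsub>N\<^esub> n) | m r n.
       m \<in> carrier M \<and> r \<in> carrier R \<and> n \<in> carrier N}"

abbreviation tensor_free ::
  "[('a, 'm, 'x) bimodule_scheme, ('a, 'n, 'y) bimodule_scheme] \<Rightarrow> ('m \<times> 'n \<Rightarrow>\<^sub>0 int) monoid"
  where "tensor_free M N \<equiv> free_Abelian_group (carrier M \<times> carrier N)"

definition tensor_null ::
  "[('a, 'r) ring_scheme, ('a, 'm, 'x) bimodule_scheme, ('a, 'n, 'y) bimodule_scheme]
    \<Rightarrow> ('m \<times> 'n \<Rightarrow>\<^sub>0 int) set"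
  where "tensor_null R M N = generate (tensor_free M N) (tensor_relators R M N)"

definition pure_tensor ::
  "[('a, 'r) ring_scheme, ('a, 'm, 'x) bimodule_scheme, ('a, 'n, 'y) bimodule_scheme, 'm, 'n]
    \<Rightarrow> ('m \<times> 'n \<Rightarrow>\<^sub>0 int) set"
  where "pure_tensor R M N m n = tensor_null R M N #>\<^bsub>tensor_free M N\<^esub> frag_of (m, n)"

text \<open>
  The actions are induced by \<open>r \<rightharpoonup> (m \<otimes> n) = (r \<rightharpoonup> m) \<otimes> n\<close> and
  \<open>(m \<otimes> n) \<leftharpoonup> r = m \<otimes> (n \<leftharpoonup> r)\<close>.  All members of a coset \<open>C\<close> yield the same coset, so the
  unions below are just that coset.
\<close>

definition tensor_bimodule ::
  "[('a, 'r) ring_scheme, ('a, 'm, 'x) bimodule_scheme, ('a, 'n, 'y) bimodule_scheme]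
    \<Rightarrow> ('a, ('m \<times> 'n \<Rightarrow>\<^sub>0 int) set) bimodule"
  where "tensor_bimodule R M N =
    \<lparr>carrier = carrier (tensor_free M N Mod tensor_null R M N),
     mult = undefined, one = undefined,
     ring.zero = \<one>\<^bsub>tensor_free M N Mod tensor_null R M N\<^esub>,
     add = (\<otimes>\<^bsub>tensor_free M N Mod tensor_null R M N\<^esub>),
     lact = (\<lambda>r C. \<Union>c\<in>C. tensor_null R M N #>\<^bsub>tensor_free M N\<^esub>
       frag_extend (\<lambda>(m, n). frag_of (r \<rightharpoonup>\<^bsub>M\<^esub> m, n)) c),
     ract = (\<lambda>C r. \<Union>c\<in>C. tensor_null R M N #>\<^bsub>tensor_free M N\<^esub>
       frag_extend (\<lambda>(m, n). frag_of (m, n \<leftharpoonup>\<^bsub>N\<^esub> r)) c)\<rparr>"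

abbreviation dual_tensor ::
  "[('k, 'c) ring_scheme, ('k, 'a, 'd) module_scheme]
    \<Rightarrow> ('a, (('a \<Rightarrow> 'k) \<times> ('a \<Rightarrow> 'k) \<Rightarrow>\<^sub>0 int) set) bimodule"
  where "dual_tensor K R \<equiv> tensor_bimodule R (dual_bimodule K R) (dual_bimodule K R)"

abbreviation dual_pure_tensor ::
  "[('k, 'c) ring_scheme, ('k, 'a, 'd) module_scheme, 'a \<Rightarrow> 'k, 'a \<Rightarrow> 'k]
    \<Rightarrow> (('a \<Rightarrow> 'k) \<times> ('a \<Rightarrow> 'k) \<Rightarrow>\<^sub>0 int) set"
  where "dual_pure_tensor K R f g \<equiv> pure_tensor R (dual_bimodule K R) (dual_bimodule K R) f g"

definition semitrivial_extension ::
  "[('k, 'c) ring_scheme, ('k, 'a, 'd) module_scheme,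
    (('a \<Rightarrow> 'k) \<times> ('a \<Rightarrow> 'k) \<Rightarrow>\<^sub>0 int) set \<Rightarrow> 'a] \<Rightarrow> ('k, 'a \<times> ('a \<Rightarrow> 'k)) module"
  where "semitrivial_extension K R \<psi> =
    \<lparr>carrier = carrier R \<times> carrier (dual_space K R),
     mult = (\<lambda>(r, f) (s, g).
       (r \<otimes>\<^bsub>R\<^esub> s \<oplus>\<^bsub>R\<^esub> \<psi> (dual_pure_tensor K R f g),
        (r \<rightharpoonup>\<^bsub>dual_bimodule K R\<^esub> g) \<oplus>\<^bsub>dual_bimodule K R\<^esub> (f \<leftharpoonup>\<^bsub>dual_bimodule K R\<^esub> s))),
     one = (\<one>\<^bsub>R\<^esub>, \<zero>\<^bsub>dual_space K R\<^esub>),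
     ring.zero = (\<zero>\<^bsub>R\<^esub>, \<zero>\<^bsub>dual_space K R\<^esub>),
     add = (\<lambda>(r, f) (s, g). (r \<oplus>\<^bsub>R\<^esub> s, f \<oplus>\<^bsub>dual_space K R\<^esub> g)),
     smult = (\<lambda>k (r, f). (k \<odot>\<^bsub>R\<^esub> r, k \<odot>\<^bsub>dual_space K R\<^esub> f))\<rparr>"

end

theory Submission
  imports Defs
begin

text \<open>
  The functional \<open>t (r, f) = f 1\<close> on the semitrivial extension satisfies
  \<open>t ((r, f) (s, g)) = g r + f s\<close>, because \<open>\<psi>\<close> only enters the first component.  This form is
  visibly symmetric, so \<open>x \<mapsto> x \<rightharpoonup> t\<close> is a bimodule homomorphism into the dual.  It is bijective
  because a functional on \<open>R \<times> R\<^sup>*\<close> is a functional on \<open>R\<close> together with one on \<open>R\<^sup>*\<close>, and the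
  latter is the evaluation at a unique \<open>s\<close> of \<open>R\<close> by finite dimensionality.
\<close>

section \<open>Dual spaces\<close>

text \<open>The form \<open>t\<close> is the one that makes the trivial extension, the case of zero
  \<open>\<psi>\<close>, symmetric: the evaluation pairing between the algebra and its dual, added
  to its transpose. After identifying the algebra with its bidual,
  \<open>x \<mapsto> x \<rightharpoonup> t\<close> just swaps the two factors. The laws of
  \<open>\<psi>\<close> go into showing that the extension is an algebra. Linearity over the
  bimodule actions and the balancing relation settle the first component of associativity, and the
  associativity hypothesis settles the second. The obstacle is the concrete tensor product. Its
  elements are cosets in a free abelian group and its actions are unions of cosets, so the actions
  have to be computed on pure tensors before \<open>\<psi>\<close> can be traded for a pairing of
  two functionals. Finite dimension is packaged as a finite family of vectors with coordinate
  functionals. This one device yields separation of points, reflexivity and a finite generating set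
  of the extension.\<close>

lemma self_module_simps [simp]:
  "carrier (self_module K) = carrier K"
  "x \<oplus>\<^bsub>self_module K\<^esub> y = x \<oplus>\<^bsub>K\<^esub> y"
  "\<zero>\<^bsub>self_module K\<^esub> = \<zero>\<^bsub>K\<^esub>"
  "x \<odot>\<^bsub>self_module K\<^esub> y = x \<otimes>\<^bsub>K\<^esub> y"
  by (simp_all add: self_module_def)

lemma (in cring) self_module_module: "module R (self_module R)"
  by (rule module_criteria)
    (auto simp: is_cring a_ac m_assoc l_distr r_distr intro: bexI[of _ "\<ominus> v" for v] r_neg)

text \<open>Unlike in \<open>hom_sum\<close>, the index set need not be a subset of the module.\<close>

lemma (in mod_hom) hom_finsum:
  assumes "g \<in> I \<rightarrow> carrier M"
  shows "f (\<Oplus>\<^bsub>M\<^esub>i\<in>I. g i) = (\<Oplus>\<^bsub>N\<^esub>i\<in>I. f (g i))"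
  using assms
proof (induction I rule: infinite_finite_induct)
  case (insert i I)
  then show ?case
    by (simp add: Pi_iff f_add)
qed auto

lemma (in module) in_dual_space_iff:
  "f \<in> carrier (dual_space R M) \<longleftrightarrow>
    f \<in> extensional (carrier M) \<and> f \<in> carrier M \<rightarrow> carrier R \<and>
    (\<forall>x\<in>carrier M. \<forall>y\<in>carrier M. f (x \<oplus>\<^bsub>M\<^esub> y) = f x \<oplus> f y) \<and>
    (\<forall>k\<in>carrier R. \<forall>x\<in>carrier M. f (k \<odot>\<^bsub>M\<^esub> x) = k \<otimes> f x)"
  by (auto simp: dual_space_def module_hom_def)

context module
begin

lemma dual_space_mem:
  assumes "f \<in> carrier (dual_space R M)"
  shows "f \<in> extensional (carrier M)"
    and dual_closed: "x \<in> carrier M \<Longrightarrow> f x \<in> carrier R"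
    and dual_add: "x \<in> carrier M \<Longrightarrow> y \<in> carrier M \<Longrightarrow> f (x \<oplus>\<^bsub>M\<^esub> y) = f x \<oplus> f y"
    and dual_smult: "k \<in> carrier R \<Longrightarrow> x \<in> carrier M \<Longrightarrow> f (k \<odot>\<^bsub>M\<^esub> x) = k \<otimes> f x"
  using assms by (auto simp: in_dual_space_iff)

lemma dual_space_ext:
  assumes "f \<in> carrier (dual_space R M)" "g \<in> carrier (dual_space R M)"
    and "\<And>x. x \<in> carrier M \<Longrightarrow> f x = g x"
  shows "f = g"
  using assms by (meson dual_space_mem(1) extensionalityI)

lemma dual_space_apply [simp]:
  assumes "x \<in> carrier M"
  shows "(f \<oplus>\<^bsub>dual_space R M\<^esub> g) x = f x \<oplus> g x"
    and "\<zero>\<^bsub>dual_space R M\<^esub> x = \<zero>"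
    and "(k \<odot>\<^bsub>dual_space R M\<^esub> f) x = k \<otimes> f x"
  using assms by (simp_all add: dual_space_def)

lemma dual_space_extensional [simp]:
  "f \<oplus>\<^bsub>dual_space R M\<^esub> g \<in> extensional (carrier M)"
  "\<zero>\<^bsub>dual_space R M\<^esub> \<in> extensional (carrier M)"
  "k \<odot>\<^bsub>dual_space R M\<^esub> f \<in> extensional (carrier M)"
  by (simp_all add: dual_space_def)

lemma dual_add_closed:
  assumes "f \<in> carrier (dual_space R M)" "g \<in> carrier (dual_space R M)"
  shows "f \<oplus>\<^bsub>dual_space R M\<^esub> g \<in> carrier (dual_space R M)"
  using assms
  by (auto simp: in_dual_space_iff r_distr Pi_iff R.add.m_assoc R.add.m_lcomm)

lemma dual_zero_closed: "\<zero>\<^bsub>dual_space R M\<^esub> \<in> carrier (dual_space R M)"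
  by (auto simp: in_dual_space_iff)

lemma dual_smult_closed:
  assumes "k \<in> carrier R" "f \<in> carrier (dual_space R M)"
  shows "k \<odot>\<^bsub>dual_space R M\<^esub> f \<in> carrier (dual_space R M)"
  using assms
  by (auto simp: in_dual_space_iff r_distr Pi_iff R.m_lcomm)

lemma dual_space_module: "module R (dual_space R M)"
proof (rule module_criteria)
  show "\<forall>f\<in>carrier (dual_space R M). \<exists>g\<in>carrier (dual_space R M).
      f \<oplus>\<^bsub>dual_space R M\<^esub> g = \<zero>\<^bsub>dual_space R M\<^esub>"
  proof
    fix f assume f: "f \<in> carrier (dual_space R M)"
    \<comment> \<open>The negative is taken as the multiple by \<open>\<ominus> \<one>\<close>, so
      that its closure is an instance of closure under scalars.\<close>
    then have "(\<ominus> \<one>) \<odot>\<^bsub>dual_space R M\<^esub> f \<in> carrier (dual_space R M)"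
      by (intro dual_smult_closed) auto
    moreover have "f \<oplus>\<^bsub>dual_space R M\<^esub> ((\<ominus> \<one>) \<odot>\<^bsub>dual_space R M\<^esub> f) = \<zero>\<^bsub>dual_space R M\<^esub>"
      using f by (intro dual_space_ext)
        (auto intro!: dual_add_closed dual_smult_closed dual_zero_closed
              simp: dual_closed R.l_minus R.r_neg)
    ultimately show "\<exists>g\<in>carrier (dual_space R M). f \<oplus>\<^bsub>dual_space R M\<^esub> g = \<zero>\<^bsub>dual_space R M\<^esub>"
      by blast
  qed
qed (auto intro!: R.is_cring dual_add_closed dual_smult_closed dual_zero_closed dual_space_ext
      simp: dual_closed R.a_ac R.m_assoc R.l_distr R.r_distr)

lemma dual_mod_hom:
  assumes "f \<in> carrier (dual_space R M)"
  shows "mod_hom R M (self_module R) f"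
  using assms
  by (intro mod_hom.intro mod_hom_axioms.intro R.self_module_module module_axioms)
    (auto simp: dual_space_def)

text \<open>Finite sums in \<open>dual_space\<close> are abstract sums over the record, not
  pointwise by definition. Linearity in the functional, together with \<open>hom_finsum\<close>,
  lets them be evaluated term by term.\<close>

lemma eval_mod_hom:
  assumes "x \<in> carrier M"
  shows "mod_hom R (dual_space R M) (self_module R) (\<lambda>f. f x)"
  using assms
  by (intro mod_hom.intro mod_hom_axioms.intro R.self_module_module dual_space_module)
    (auto simp: module_hom_def dual_closed)

end

section \<open>Dual bases and reflexivity of finite-dimensional spaces\<close>

context vectorspace
begin

text \<open>This is a dual basis in the sense of finitely generated projective modules: functionals
  that reconstruct every vector. Reconstruction is the property from which the expansions of
  vectors, of functionals and of functionals on the dual are all derived.\<close>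

definition coordinates :: "'c set \<Rightarrow> ('c \<Rightarrow> 'c \<Rightarrow> 'a) \<Rightarrow> bool"
  where "coordinates B d \<longleftrightarrow>
    finite B \<and> B \<subseteq> carrier V \<and> d \<in> B \<rightarrow> carrier (dual_space K V) \<and>
    (\<forall>x\<in>carrier V. (\<Oplus>\<^bsub>V\<^esub>v\<in>B. d v x \<odot>\<^bsub>V\<^esub> v) = x)"

lemma coordinatesD:
  assumes "coordinates B d"
  shows "finite B" "B \<subseteq> carrier V" "d \<in> B \<rightarrow> carrier (dual_space K V)"
    and "x \<in> carrier V \<Longrightarrow> (\<Oplus>\<^bsub>V\<^esub>v\<in>B. d v x \<odot>\<^bsub>V\<^esub> v) = x"
  using assms by (simp_all add: coordinates_def)

text \<open>Coefficients with respect to a basis are unique. The sum of the coefficients of two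
  vectors represents the sum of the vectors, so it must be the coefficient family of that sum;
  scalar multiples are treated alike. Hence the coordinate functions are linear.\<close>

lemma coordinates_exist:
  assumes fin_dim
  obtains B d where "coordinates B d"
proof -
  obtain B where B: "finite B" "basis B"
    using finite_basis_exists[OF assms] by blast
  then have BV: "B \<subseteq> carrier V"
    by (simp add: basis_def)
  have ex1: "\<exists>!a. a \<in> B \<rightarrow>\<^sub>E carrier K \<and> lincomb a B = x" if "x \<in> carrier V" for x
    using basis_criterion[OF B(1) BV] B(2) that by blast
  define c where "c x = (THE a. a \<in> B \<rightarrow>\<^sub>E carrier K \<and> lincomb a B = x)" for x
  have c: "c x \<in> B \<rightarrow>\<^sub>E carrier K" "lincomb (c x) B = x" if "x \<in> carrier V" for x
    using theI'[OF ex1[OF that]] by (auto simp: c_def)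
  \<comment> \<open>Uniqueness holds literally only among extensional coefficient functions. An
    arbitrary \<open>a\<close> is therefore cut down to \<open>B\<close>, which changes neither its
    linear combination nor its value at \<open>v\<close>.\<close>
  have c_eq: "c x v = a v" if "v \<in> B" "a \<in> B \<rightarrow> carrier K" "lincomb a B = x" for a x v
  proof -
    have "x \<in> carrier V"
      using lincomb_closed[OF BV that(2)] that(3) by simp
    moreover have "restrict a B \<in> B \<rightarrow>\<^sub>E carrier K"
      using that(2) by auto
    moreover have "lincomb (restrict a B) B = x"
      using that BV unfolding lincomb_def
      by (auto intro!: finsum_cong' simp: Pi_iff)
    ultimately have "c x = restrict a B"
      using ex1 c by blast
    then show ?thesis
      using that(1) by simp
  qed
  define d where "d v = (\<lambda>x\<in>carrier V. c x v)" for v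
  have cK: "c x v \<in> carrier K" if "x \<in> carrier V" "v \<in> B" for x v
    using c(1)[OF that(1)] that(2) by auto
  have "d v \<in> carrier (dual_space K V)" if v: "v \<in> B" for v
    unfolding in_dual_space_iff
  proof (intro conjI ballI)
    fix x y assume xy: "x \<in> carrier V" "y \<in> carrier V"
    have "c (x \<oplus>\<^bsub>V\<^esub> y) v = c x v \<oplus>\<^bsub>K\<^esub> c y v"
      using xy c cK lincomb_sum[OF B(1) BV, of "c x" "c y"]
      by (intro c_eq[OF v]) auto
    then show "d v (x \<oplus>\<^bsub>V\<^esub> y) = d v x \<oplus>\<^bsub>K\<^esub> d v y"
      using xy by (simp add: d_def)
  next
    fix k x assume kx: "k \<in> carrier K" "x \<in> carrier V"
    have "c (k \<odot>\<^bsub>V\<^esub> x) v = k \<otimes>\<^bsub>K\<^esub> c x v"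
      using kx c cK lincomb_smult[OF BV, of "c x" k]
      by (intro c_eq[OF v]) auto
    then show "d v (k \<odot>\<^bsub>V\<^esub> x) = k \<otimes>\<^bsub>K\<^esub> d v x"
      using kx by (simp add: d_def)
  qed (use v cK in \<open>auto simp: d_def\<close>)
  moreover have "(\<Oplus>\<^bsub>V\<^esub>v\<in>B. d v x \<odot>\<^bsub>V\<^esub> v) = x" if "x \<in> carrier V" for x
    using c(2)[OF that] that by (simp add: lincomb_def d_def)
  ultimately show thesis
    using B(1) BV by (intro that[of B d]) (auto simp: coordinates_def)
qed

text \<open>Applying \<open>f\<close> to the reconstruction of \<open>x\<close> gives the sum of the
  products of \<open>d v x\<close> and \<open>f v\<close>. Read as a function of \<open>x\<close>,
  and with the factors commuted in \<open>K\<close>, this is a combination of the functionals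
  \<open>d v\<close>.\<close>

lemma dual_expansion:
  assumes Bd: "coordinates B d"
    and f: "f \<in> carrier (dual_space K V)"
  shows "f = (\<Oplus>\<^bsub>dual_space K V\<^esub>v\<in>B. f v \<odot>\<^bsub>dual_space K V\<^esub> d v)"
proof -
  note B = coordinatesD(1-3)[OF Bd] and expand = coordinatesD(4)[OF Bd]
  interpret D: module K "dual_space K V"
    by (rule dual_space_module)
  interpret S: module K "self_module K"
    by (rule self_module_module)
  interpret f: mod_hom K V "self_module K" f
    by (rule dual_mod_hom[OF f])
  have terms: "(\<lambda>v. f v \<odot>\<^bsub>dual_space K V\<^esub> d v) \<in> B \<rightarrow> carrier (dual_space K V)"
    using B(2,3) dual_closed[OF f] by auto
  show ?thesis
  proof (rule dual_space_ext[OF f])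
    show "(\<Oplus>\<^bsub>dual_space K V\<^esub>v\<in>B. f v \<odot>\<^bsub>dual_space K V\<^esub> d v) \<in> carrier (dual_space K V)"
      using terms by (rule D.finsum_closed)
    fix x assume x: "x \<in> carrier V"
    interpret e: mod_hom K "dual_space K V" "self_module K" "\<lambda>f. f x"
      by (rule eval_mod_hom[OF x])
    have dx: "d v x \<in> carrier K" if "v \<in> B" for v
      using that B(3) dual_closed x by auto
    have "f x = f (\<Oplus>\<^bsub>V\<^esub>v\<in>B. d v x \<odot>\<^bsub>V\<^esub> v)"
      using expand[OF x] by simp
    also have "\<dots> = (\<Oplus>\<^bsub>self_module K\<^esub>v\<in>B. f (d v x \<odot>\<^bsub>V\<^esub> v))"
      by (rule f.hom_finsum) (use B(2) dx in auto)
    also have "\<dots> = (\<Oplus>\<^bsub>self_module K\<^esub>v\<in>B. (f v \<odot>\<^bsub>dual_space K V\<^esub> d v) x)"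
      by (rule S.finsum_cong')
        (use B(2) dx x dual_closed[OF f] in \<open>auto simp: dual_smult[OF f] m_comm\<close>)
    also have "\<dots> = (\<Oplus>\<^bsub>dual_space K V\<^esub>v\<in>B. f v \<odot>\<^bsub>dual_space K V\<^esub> d v) x"
      by (rule e.hom_finsum[symmetric]) (use terms in auto)
    finally show "f x = \<dots>" .
  qed
qed

text \<open>The functionals \<open>d v\<close> of a coordinate system already determine a vector,
  since it is rebuilt from their values.\<close>

lemma dual_separates:
  assumes fin_dim "x \<in> carrier V" "y \<in> carrier V"
    and "\<And>f. f \<in> carrier (dual_space K V) \<Longrightarrow> f x = f y"
  shows "x = y"
proof -
  obtain B d where Bd: "coordinates B d"
    by (rule coordinates_exist[OF assms(1)])
  note B = coordinatesD(2,3)[OF Bd] and expand = coordinatesD(4)[OF Bd]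
  have "x = (\<Oplus>\<^bsub>V\<^esub>v\<in>B. d v x \<odot>\<^bsub>V\<^esub> v)"
    by (rule expand[OF assms(2), symmetric])
  also have "\<dots> = (\<Oplus>\<^bsub>V\<^esub>v\<in>B. d v y \<odot>\<^bsub>V\<^esub> v)"
  proof (rule finsum_cong')
    show "(\<lambda>v. d v y \<odot>\<^bsub>V\<^esub> v) \<in> B \<rightarrow> carrier V"
      using B assms(3) by (auto simp: dual_closed Pi_iff subset_iff)
    show "d v x \<odot>\<^bsub>V\<^esub> v = d v y \<odot>\<^bsub>V\<^esub> v" if "v \<in> B" for v
      using assms(4)[of "d v"] B(2) that by (simp add: Pi_iff)
  qed simp
  also have "\<dots> = y"
    by (rule expand[OF assms(3)])
  finally show ?thesis .
qed

text \<open>This is surjectivity of the canonical map into the bidual. \<open>F\<close> is given as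
  a \<open>mod_hom\<close> and not as a member of an iterated \<open>dual_space\<close>, so it need
  not be extensional on functionals.\<close>

lemma dual_reflexive:
  assumes fin_dim
    and F: "mod_hom K (dual_space K V) (self_module K) F"
  obtains s where "s \<in> carrier V" "\<And>f. f \<in> carrier (dual_space K V) \<Longrightarrow> F f = f s"
proof -
  obtain B d where Bd: "coordinates B d"
    by (rule coordinates_exist[OF assms(1)])
  note B = coordinatesD(1-3)[OF Bd]
  interpret S: module K "self_module K"
    by (rule self_module_module)
  interpret F: mod_hom K "dual_space K V" "self_module K" F
    by (rule F)
  have Fd: "F (d v) \<in> carrier K" if "v \<in> B" for v
    using F.f_im[of "d v"] B(3) that by (simp add: Pi_iff)
  have terms: "(\<lambda>v. F (d v) \<odot>\<^bsub>V\<^esub> v) \<in> B \<rightarrow> carrier V"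
    using B Fd by auto
  \<comment> \<open>The choice is forced: expanding \<open>f\<close> gives \<open>F f\<close> as the
    sum of the products of \<open>f v\<close> and \<open>F (d v)\<close>, which is \<open>f\<close>
    applied to this combination of the vectors \<open>v\<close>.\<close>
  define s where "s = (\<Oplus>\<^bsub>V\<^esub>v\<in>B. F (d v) \<odot>\<^bsub>V\<^esub> v)"
  have "s \<in> carrier V"
    unfolding s_def using terms by (rule finsum_closed)
  moreover have "F f = f s" if f: "f \<in> carrier (dual_space K V)" for f
  proof -
    interpret f: mod_hom K V "self_module K" f
      by (rule dual_mod_hom[OF f])
    have fB: "f v \<in> carrier K" if "v \<in> B" for v
      using that B(2) dual_closed[OF f] by auto
    have "F f = F (\<Oplus>\<^bsub>dual_space K V\<^esub>v\<in>B. f v \<odot>\<^bsub>dual_space K V\<^esub> d v)"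
      using dual_expansion[OF Bd f] by simp
    also have "\<dots> = (\<Oplus>\<^bsub>self_module K\<^esub>v\<in>B. F (f v \<odot>\<^bsub>dual_space K V\<^esub> d v))"
      by (rule F.hom_finsum) (use B(3) fB in auto)
    also have "\<dots> = (\<Oplus>\<^bsub>self_module K\<^esub>v\<in>B. f (F (d v) \<odot>\<^bsub>V\<^esub> v))"
      by (rule S.finsum_cong')
        (use B fB Fd in \<open>auto simp: dual_smult[OF f] F.f_smult Pi_iff subset_iff m_comm\<close>)
    also have "\<dots> = f s"
      unfolding s_def by (rule f.hom_finsum[symmetric]) (use B terms in auto)
    finally show ?thesis .
  qed
  ultimately show thesis
    by (rule that)
qed

end

section \<open>Bimodules and their tensor products\<close>

text \<open>The record \<open>bimodule\<close> supplies operations only; the laws are collected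
  here. For \<open>M\<close> just \<open>abelian_group\<close> is required, which leaves its
  meaningless ring multiplication and unit unconstrained.\<close>

locale bimod = R?: ring R + M?: abelian_group M
  for R :: "('a, 'r) ring_scheme" (structure) and M :: "('a, 'm, 'x) bimodule_scheme" (structure) +
  assumes lact_closed: "\<lbrakk>r \<in> carrier R; m \<in> carrier M\<rbrakk> \<Longrightarrow> r \<rightharpoonup>\<^bsub>M\<^esub> m \<in> carrier M"
    and ract_closed: "\<lbrakk>r \<in> carrier R; m \<in> carrier M\<rbrakk> \<Longrightarrow> m \<leftharpoonup>\<^bsub>M\<^esub> r \<in> carrier M"
    and lact_add: "\<lbrakk>r \<in> carrier R; m \<in> carrier M; m' \<in> carrier M\<rbrakk> \<Longrightarrow>
      r \<rightharpoonup>\<^bsub>M\<^esub> (m \<oplus>\<^bsub>M\<^esub> m') = (r \<rightharpoonup>\<^bsub>M\<^esub> m) \<oplus>\<^bsub>M\<^esub> (r \<rightharpoonup>\<^bsub>M\<^esub> m')"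
    and ract_add: "\<lbrakk>r \<in> carrier R; m \<in> carrier M; m' \<in> carrier M\<rbrakk> \<Longrightarrow>
      (m \<oplus>\<^bsub>M\<^esub> m') \<leftharpoonup>\<^bsub>M\<^esub> r = (m \<leftharpoonup>\<^bsub>M\<^esub> r) \<oplus>\<^bsub>M\<^esub> (m' \<leftharpoonup>\<^bsub>M\<^esub> r)"
    and add_lact: "\<lbrakk>r \<in> carrier R; s \<in> carrier R; m \<in> carrier M\<rbrakk> \<Longrightarrow>
      (r \<oplus>\<^bsub>R\<^esub> s) \<rightharpoonup>\<^bsub>M\<^esub> m = (r \<rightharpoonup>\<^bsub>M\<^esub> m) \<oplus>\<^bsub>M\<^esub> (s \<rightharpoonup>\<^bsub>M\<^esub> m)"
    and add_ract: "\<lbrakk>r \<in> carrier R; s \<in> carrier R; m \<in> carrier M\<rbrakk> \<Longrightarrow>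
      m \<leftharpoonup>\<^bsub>M\<^esub> (r \<oplus>\<^bsub>R\<^esub> s) = (m \<leftharpoonup>\<^bsub>M\<^esub> r) \<oplus>\<^bsub>M\<^esub> (m \<leftharpoonup>\<^bsub>M\<^esub> s)"
    and lact_lact: "\<lbrakk>r \<in> carrier R; s \<in> carrier R; m \<in> carrier M\<rbrakk> \<Longrightarrow>
      r \<rightharpoonup>\<^bsub>M\<^esub> (s \<rightharpoonup>\<^bsub>M\<^esub> m) = (r \<otimes>\<^bsub>R\<^esub> s) \<rightharpoonup>\<^bsub>M\<^esub> m"
    and ract_ract: "\<lbrakk>r \<in> carrier R; s \<in> carrier R; m \<in> carrier M\<rbrakk> \<Longrightarrow>
      (m \<leftharpoonup>\<^bsub>M\<^esub> r) \<leftharpoonup>\<^bsub>M\<^esub> s = m \<leftharpoonup>\<^bsub>M\<^esub> (r \<otimes>\<^bsub>R\<^esub> s)"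
    and lact_ract: "\<lbrakk>r \<in> carrier R; s \<in> carrier R; m \<in> carrier M\<rbrakk> \<Longrightarrow>
      (r \<rightharpoonup>\<^bsub>M\<^esub> m) \<leftharpoonup>\<^bsub>M\<^esub> s = r \<rightharpoonup>\<^bsub>M\<^esub> (m \<leftharpoonup>\<^bsub>M\<^esub> s)"
    and one_lact: "m \<in> carrier M \<Longrightarrow> \<one>\<^bsub>R\<^esub> \<rightharpoonup>\<^bsub>M\<^esub> m = m"
    and one_ract: "m \<in> carrier M \<Longrightarrow> m \<leftharpoonup>\<^bsub>M\<^esub> \<one>\<^bsub>R\<^esub> = m"

locale bimod_pair = M: bimod R M + N: bimod R N for R M N
begin

abbreviation "G \<equiv> tensor_free M N"
abbreviation "H \<equiv> tensor_null R M N"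
abbreviation "T \<equiv> tensor_bimodule R M N"

lemma tensor_relators_subset: "tensor_relators R M N \<subseteq> carrier G"
proof -
  \<comment> \<open>Membership in the free group is kept folded below, so that this rule splits a
    relator into its generators instead of unfolding to a claim about supports.\<close>
  have diff: "a - b \<in> carrier G" if "a \<in> carrier G" "b \<in> carrier G" for a b
    using that keys_diff[of a b] by auto
  show ?thesis
    unfolding tensor_relators_def
    by (auto intro!: diff simp: M.ract_closed N.lact_closed
        simp del: carrier_free_Abelian_group_iff)
qed

lemma tensor_null_subgroup: "subgroup H G"
  unfolding tensor_null_def
  by (rule group.generate_is_subgroup[OF group_free_Abelian_group tensor_relators_subset])

lemma tensor_null_normal: "H \<lhd> G"
  by (simp add: comm_group.normal_iff_subgroup[OF abelian_free_Abelian_group] tensor_null_subgroup)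

lemma tensor_null_closed:
  shows "a \<in> H \<Longrightarrow> b \<in> H \<Longrightarrow> a + b \<in> H"
    and "a \<in> H \<Longrightarrow> - a \<in> H"
    and "a \<in> H \<Longrightarrow> a \<in> carrier G"
proof -
  show car: "a \<in> H \<Longrightarrow> a \<in> carrier G" for a
    using subgroup.subset[OF tensor_null_subgroup] by blast
  show "a \<in> H \<Longrightarrow> b \<in> H \<Longrightarrow> a + b \<in> H"
    using subgroup.m_closed[OF tensor_null_subgroup] by simp
  show "- a \<in> H" if "a \<in> H"
    using subgroup.m_inv_closed[OF tensor_null_subgroup that] car[OF that] by simp
qed

lemma tensor_coset_eqI:
  assumes "a \<in> carrier G" "b \<in> carrier G" "b - a \<in> H"
  shows "H #>\<^bsub>G\<^esub> a = H #>\<^bsub>G\<^esub> b"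
proof (rule group.repr_independence[OF group_free_Abelian_group _ assms(1) tensor_null_subgroup])
  show "b \<in> H #>\<^bsub>G\<^esub> a"
    using assms(3) by (auto simp: r_coset_def intro: bexI[of _ "b - a"])
qed

lemma tensor_relators_in_null: "tensor_relators R M N \<subseteq> H"
  by (auto simp: tensor_null_def intro: generate.incl)

lemma tensor_coset_closed: "a \<in> carrier G \<Longrightarrow> H #>\<^bsub>G\<^esub> a \<in> carrier T"
  by (auto simp: tensor_bimodule_def FactGroup_def RCOSETS_def)

lemma pure_tensor_closed:
  "\<lbrakk>m \<in> carrier M; n \<in> carrier N\<rbrakk> \<Longrightarrow> pure_tensor R M N m n \<in> carrier T"
  unfolding pure_tensor_def by (rule tensor_coset_closed) simp

lemma tensor_coset_add:
  "\<lbrakk>a \<in> carrier G; b \<in> carrier G\<rbrakk> \<Longrightarrow> (H #>\<^bsub>G\<^esub> a) \<oplus>\<^bsub>T\<^esub> (H #>\<^bsub>G\<^esub> b) = H #>\<^bsub>G\<^esub> (a + b)"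
  using normal.rcos_sum[OF tensor_null_normal, of a b]
  by (simp add: tensor_bimodule_def FactGroup_def)

lemma pure_tensor_add_left:
  assumes "m \<in> carrier M" "m' \<in> carrier M" "n \<in> carrier N"
  shows "pure_tensor R M N (m \<oplus>\<^bsub>M\<^esub> m') n = pure_tensor R M N m n \<oplus>\<^bsub>T\<^esub> pure_tensor R M N m' n"
proof -
  have "frag_of (m \<oplus>\<^bsub>M\<^esub> m', n) - (frag_of (m, n) + frag_of (m', n)) \<in> tensor_relators R M N"
    unfolding tensor_relators_def using assms by (auto simp: diff_diff_add)
  moreover have "frag_of (m, n) + frag_of (m', n) \<in> carrier G"
    using assms keys_add[of "frag_of (m, n)" "frag_of (m', n)"] by auto
  ultimately have "H #>\<^bsub>G\<^esub> (frag_of (m, n) + frag_of (m', n)) = H #>\<^bsub>G\<^esub> frag_of (m \<oplus>\<^bsub>M\<^esub> m', n)"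
    using assms tensor_relators_in_null by (intro tensor_coset_eqI) auto
  then show ?thesis
    using assms by (simp add: pure_tensor_def tensor_coset_add)
qed

lemma pure_tensor_add_right:
  assumes "m \<in> carrier M" "n \<in> carrier N" "n' \<in> carrier N"
  shows "pure_tensor R M N m (n \<oplus>\<^bsub>N\<^esub> n') = pure_tensor R M N m n \<oplus>\<^bsub>T\<^esub> pure_tensor R M N m n'"
proof -
  have "frag_of (m, n \<oplus>\<^bsub>N\<^esub> n') - (frag_of (m, n) + frag_of (m, n')) \<in> tensor_relators R M N"
    unfolding tensor_relators_def using assms by (auto simp: diff_diff_add)
  moreover have "frag_of (m, n) + frag_of (m, n') \<in> carrier G"
    using assms keys_add[of "frag_of (m, n)" "frag_of (m, n')"] by auto
  ultimately have "H #>\<^bsub>G\<^esub> (frag_of (m, n) + frag_of (m, n')) = H #>\<^bsub>G\<^esub> frag_of (m, n \<oplus>\<^bsub>N\<^esub> n')"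
    using assms tensor_relators_in_null by (intro tensor_coset_eqI) auto
  then show ?thesis
    using assms by (simp add: pure_tensor_def tensor_coset_add)
qed

lemma pure_tensor_balanced:
  assumes "m \<in> carrier M" "r \<in> carrier R" "n \<in> carrier N"
  shows "pure_tensor R M N (m \<leftharpoonup>\<^bsub>M\<^esub> r) n = pure_tensor R M N m (r \<rightharpoonup>\<^bsub>N\<^esub> n)"
proof -
  have "frag_of (m \<leftharpoonup>\<^bsub>M\<^esub> r, n) - frag_of (m, r \<rightharpoonup>\<^bsub>N\<^esub> n) \<in> tensor_relators R M N"
    unfolding tensor_relators_def using assms by auto
  then show ?thesis
    unfolding pure_tensor_def using assms tensor_relators_in_null
    by (intro tensor_coset_eqI[symmetric]) (auto simp: M.ract_closed N.lact_closed)
qed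

text \<open>An additive map that sends the relators into \<open>H\<close> sends all of
  \<open>H\<close> into \<open>H\<close>. The images of the members of a coset then lie in a single
  coset, and the union collapses to it. A general \<open>b\<close> serves both the left and the
  right action.\<close>

lemma frag_extend_coset:
  assumes x: "x \<in> carrier G" and b: "b ` (carrier M \<times> carrier N) \<subseteq> carrier G"
    and rel: "\<And>c. c \<in> tensor_relators R M N \<Longrightarrow> frag_extend b c \<in> H"
  shows "(\<Union>c\<in>H #>\<^bsub>G\<^esub> x. H #>\<^bsub>G\<^esub> frag_extend b c) = H #>\<^bsub>G\<^esub> frag_extend b x"
proof -
  have b_closed: "frag_extend b c \<in> carrier G" if "c \<in> carrier G" for c
  proof -
    have "Poly_Mapping.keys c \<subseteq> carrier M \<times> carrier N"
      using that by simp
    then show ?thesis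
    proof (induction c rule: frag_induction)
      case (one x)
      then show ?case
        using b by (auto simp del: carrier_free_Abelian_group_iff)
    next
      case (diff c d)
      then show ?case
        using keys_diff[of "frag_extend b c" "frag_extend b d"] by (auto simp: frag_extend_diff)
    qed simp
  qed
  have null: "frag_extend b c \<in> H" if "c \<in> H" for c
    using that unfolding tensor_null_def
  proof (induction c rule: generate.induct)
    case one
    then show ?case
      using generate.one[of G] by simp
  next
    case (incl c)
    then show ?case
      using rel by (simp add: tensor_null_def)
  next
    case (inv c)
    then have "c \<in> carrier G"
      using tensor_relators_subset by blast
    then show ?case
      using tensor_null_closed(2)[OF rel[OF inv]] by (simp add: frag_extend_minus tensor_null_def)
  next
    case (eng c d)
    then show ?case
      using tensor_null_closed(1) by (simp add: frag_extend_add tensor_null_def)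
  qed
  have "H #>\<^bsub>G\<^esub> frag_extend b c = H #>\<^bsub>G\<^esub> frag_extend b x" if c: "c \<in> H #>\<^bsub>G\<^esub> x" for c
  proof -
    obtain h where h: "h \<in> H" "c = h + x"
      using c by (auto simp: r_coset_def)
    then have "c \<in> carrier G"
      using tensor_null_closed(3)[of h] x keys_add[of h x] by auto
    with h show ?thesis
      by (intro tensor_coset_eqI[symmetric] b_closed x) (simp_all add: frag_extend_add null)
  qed
  \<comment> \<open>The index set of the union is nonempty; otherwise the union would be empty and
    not a coset.\<close>
  moreover have "x \<in> H #>\<^bsub>G\<^esub> x"
    using group.rcos_self[OF group_free_Abelian_group x tensor_null_subgroup] .
  ultimately show ?thesis
    by blast
qed

text \<open>Acting on the first factor maps each family of relators into itself: additivity of the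
  action handles the first family, the second is immediate, and the balancing relators survive
  because the left and right actions on \<open>M\<close> commute.\<close>

lemma lact_pure_tensor:
  assumes r: "r \<in> carrier R" and mn: "m \<in> carrier M" "n \<in> carrier N"
  shows "r \<rightharpoonup>\<^bsub>T\<^esub> pure_tensor R M N m n = pure_tensor R M N (r \<rightharpoonup>\<^bsub>M\<^esub> m) n"
proof -
  have "r \<rightharpoonup>\<^bsub>T\<^esub> pure_tensor R M N m n =
      H #>\<^bsub>G\<^esub> frag_extend (\<lambda>(m, n). frag_of (r \<rightharpoonup>\<^bsub>M\<^esub> m, n)) (frag_of (m, n))"
    unfolding tensor_bimodule_def pure_tensor_def bimodule.simps
  proof (rule frag_extend_coset)
    fix c assume "c \<in> tensor_relators R M N"
    then have "frag_extend (\<lambda>(m, n). frag_of (r \<rightharpoonup>\<^bsub>M\<^esub> m, n)) c \<in> tensor_relators R M N"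
    proof (unfold tensor_relators_def, elim UnE CollectE exE conjE, hypsubst, goal_cases)
      case (1 m m' n)
      then show ?case
        using r by (intro UnI1 CollectI exI[of _ "r \<rightharpoonup>\<^bsub>M\<^esub> m"] exI[of _ "r \<rightharpoonup>\<^bsub>M\<^esub> m'"] exI[of _ n])
          (simp add: frag_extend_diff M.lact_add M.lact_closed)
    next
      case (2 m n n')
      then show ?case
        using r by (intro UnI1[OF UnI2] CollectI exI[of _ "r \<rightharpoonup>\<^bsub>M\<^esub> m"] exI[of _ n] exI[of _ n'])
          (simp add: frag_extend_diff M.lact_closed)
    next
      case (3 m s n)
      then show ?case
        using r by (intro UnI2 CollectI exI[of _ "r \<rightharpoonup>\<^bsub>M\<^esub> m"] exI[of _ s] exI[of _ n])
          (simp add: frag_extend_diff M.lact_closed M.lact_ract)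
    qed
    then show "frag_extend (\<lambda>(m, n). frag_of (r \<rightharpoonup>\<^bsub>M\<^esub> m, n)) c \<in> H"
      using tensor_relators_in_null by blast
  qed (use r mn in \<open>auto simp: M.lact_closed\<close>)
  then show ?thesis
    by (simp add: pure_tensor_def)
qed

text \<open>Mirror image of the left action: additivity is now used for the second family of
  relators, and the commuting actions of \<open>N\<close> for the balancing relators.\<close>

lemma pure_tensor_ract:
  assumes r: "r \<in> carrier R" and mn: "m \<in> carrier M" "n \<in> carrier N"
  shows "pure_tensor R M N m n \<leftharpoonup>\<^bsub>T\<^esub> r = pure_tensor R M N m (n \<leftharpoonup>\<^bsub>N\<^esub> r)"
proof -
  have "pure_tensor R M N m n \<leftharpoonup>\<^bsub>T\<^esub> r =
      H #>\<^bsub>G\<^esub> frag_extend (\<lambda>(m, n). frag_of (m, n \<leftharpoonup>\<^bsub>N\<^esub> r)) (frag_of (m, n))"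
    unfolding tensor_bimodule_def pure_tensor_def bimodule.simps
  proof (rule frag_extend_coset)
    fix c assume "c \<in> tensor_relators R M N"
    then have "frag_extend (\<lambda>(m, n). frag_of (m, n \<leftharpoonup>\<^bsub>N\<^esub> r)) c \<in> tensor_relators R M N"
    proof (unfold tensor_relators_def, elim UnE CollectE exE conjE, hypsubst, goal_cases)
      case (1 m m' n)
      then show ?case
        using r by (intro UnI1 CollectI exI[of _ m] exI[of _ m'] exI[of _ "n \<leftharpoonup>\<^bsub>N\<^esub> r"])
          (simp add: frag_extend_diff N.ract_closed)
    next
      case (2 m n n')
      then show ?case
        using r by (intro UnI1[OF UnI2] CollectI exI[of _ m] exI[of _ "n \<leftharpoonup>\<^bsub>N\<^esub> r"] exI[of _ "n' \<leftharpoonup>\<^bsub>N\<^esub> r"])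
          (simp add: frag_extend_diff N.ract_closed N.ract_add)
    next
      case (3 m s n)
      then show ?case
        using r by (intro UnI2 CollectI exI[of _ m] exI[of _ s] exI[of _ "n \<leftharpoonup>\<^bsub>N\<^esub> r"])
          (simp add: frag_extend_diff N.ract_closed N.lact_ract)
    qed
    then show "frag_extend (\<lambda>(m, n). frag_of (m, n \<leftharpoonup>\<^bsub>N\<^esub> r)) c \<in> H"
      using tensor_relators_in_null by blast
  qed (use r mn in \<open>auto simp: N.ract_closed\<close>)
  then show ?thesis
    by (simp add: pure_tensor_def)
qed

end

section \<open>The dual bimodule of an algebra\<close>

context fin_dim_algebra
begin

lemma dual_bimodule_simps [simp]:
  "carrier (dual_bimodule K A) = carrier (dual_space K A)"
  "f \<oplus>\<^bsub>dual_bimodule K A\<^esub> g = f \<oplus>\<^bsub>dual_space K A\<^esub> g"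
  "\<zero>\<^bsub>dual_bimodule K A\<^esub> = \<zero>\<^bsub>dual_space K A\<^esub>"
  by (simp_all add: dual_bimodule_def)

lemma dual_bimodule_apply [simp]:
  assumes "x \<in> carrier A"
  shows "(r \<rightharpoonup>\<^bsub>dual_bimodule K A\<^esub> f) x = f (x \<otimes> r)"
    and "(f \<leftharpoonup>\<^bsub>dual_bimodule K A\<^esub> r) x = f (r \<otimes> x)"
  using assms by (simp_all add: dual_bimodule_def)

lemma dual_bimodule_extensional [simp]:
  "r \<rightharpoonup>\<^bsub>dual_bimodule K A\<^esub> f \<in> extensional (carrier A)"
  "f \<leftharpoonup>\<^bsub>dual_bimodule K A\<^esub> r \<in> extensional (carrier A)"
  by (simp_all add: dual_bimodule_def)

lemma dual_action_closed:
  assumes "r \<in> carrier A" "f \<in> carrier (dual_space K A)"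
  shows "r \<rightharpoonup>\<^bsub>dual_bimodule K A\<^esub> f \<in> carrier (dual_space K A)"
    and "f \<leftharpoonup>\<^bsub>dual_bimodule K A\<^esub> r \<in> carrier (dual_space K A)"
  using assms
  by (auto simp: in_dual_space_iff A.l_distr A.r_distr smult_mult_left smult_mult_right Pi_iff)

text \<open>Multiplying the argument on the right gives a left action, as both
  \<open>r \<rightharpoonup> (s \<rightharpoonup> f)\<close> and the action of the product take
  \<open>a\<close> to \<open>f (a \<otimes> r \<otimes> s)\<close>. Every law reduces pointwise to
  one in \<open>A\<close> or to additivity of functionals.\<close>

lemma dual_bimodule_bimod: "bimod A (dual_bimodule K A)"
proof -
  interpret D: module K "dual_space K A"
    by (rule dual_space_module)
  have "abelian_group (dual_bimodule K A)"
  proof (rule abelian_groupI)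
    show "\<exists>g\<in>carrier (dual_bimodule K A). g \<oplus>\<^bsub>dual_bimodule K A\<^esub> f = \<zero>\<^bsub>dual_bimodule K A\<^esub>"
      if "f \<in> carrier (dual_bimodule K A)" for f
      using that D.l_neg[of f] D.a_inv_closed[of f] by auto
  qed (auto simp: D.a_ac)
  then show ?thesis
    by (intro bimod.intro bimod_axioms.intro A.ring_axioms)
      (auto intro!: dual_space_ext dual_add_closed dual_action_closed
        simp: dual_add A.m_assoc A.l_distr A.r_distr)
qed

text \<open>Besides giving compatibility of scalars with the product of the extension, the first two
  equations at the unit identify scalar multiplication on the dual with the action of
  \<open>k \<odot> \<one>\<close>.\<close>

lemma dual_action_smult:
  assumes "k \<in> carrier K" "r \<in> carrier A" "f \<in> carrier (dual_space K A)"
  shows "(k \<odot>\<^bsub>A\<^esub> r) \<rightharpoonup>\<^bsub>dual_bimodule K A\<^esub> f =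
      k \<odot>\<^bsub>dual_space K A\<^esub> (r \<rightharpoonup>\<^bsub>dual_bimodule K A\<^esub> f)"
    and "f \<leftharpoonup>\<^bsub>dual_bimodule K A\<^esub> (k \<odot>\<^bsub>A\<^esub> r) =
      k \<odot>\<^bsub>dual_space K A\<^esub> (f \<leftharpoonup>\<^bsub>dual_bimodule K A\<^esub> r)"
    and "r \<rightharpoonup>\<^bsub>dual_bimodule K A\<^esub> (k \<odot>\<^bsub>dual_space K A\<^esub> f) =
      k \<odot>\<^bsub>dual_space K A\<^esub> (r \<rightharpoonup>\<^bsub>dual_bimodule K A\<^esub> f)"
    and "(k \<odot>\<^bsub>dual_space K A\<^esub> f) \<leftharpoonup>\<^bsub>dual_bimodule K A\<^esub> r =
      k \<odot>\<^bsub>dual_space K A\<^esub> (f \<leftharpoonup>\<^bsub>dual_bimodule K A\<^esub> r)"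
  using assms
  by (auto intro!: dual_space_ext dual_smult_closed dual_action_closed
      simp: dual_smult smult_mult_left smult_mult_right)

text \<open>The classical criterion by a nondegenerate trace form. Additivity and left linearity of
  the map hold for any \<open>t\<close>; the trace property supplies right linearity, and
  nondegeneracy is bijectivity.\<close>

lemma symmetric_algebraI:
  assumes t: "t \<in> carrier (dual_space K A)"
    and t_comm: "\<And>x y. \<lbrakk>x \<in> carrier A; y \<in> carrier A\<rbrakk> \<Longrightarrow> t (x \<otimes> y) = t (y \<otimes> x)"
    and bij: "bij_betw (\<lambda>x. x \<rightharpoonup>\<^bsub>dual_bimodule K A\<^esub> t) (carrier A) (carrier (dual_space K A))"
  shows "symmetric_algebra K A"
proof -
  interpret D: bimod A "dual_bimodule K A"
    by (rule dual_bimodule_bimod)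
  have "(x \<otimes> r) \<rightharpoonup>\<^bsub>dual_bimodule K A\<^esub> t =
      (x \<rightharpoonup>\<^bsub>dual_bimodule K A\<^esub> t) \<leftharpoonup>\<^bsub>dual_bimodule K A\<^esub> r"
    if "x \<in> carrier A" "r \<in> carrier A" for x r
  proof (rule dual_space_ext)
    fix y assume y: "y \<in> carrier A"
    \<comment> \<open>Right linearity asks to carry \<open>r\<close> from the far right of the
      argument to the far left, which is one cyclic move under \<open>t\<close>.\<close>
    have "t (y \<otimes> (x \<otimes> r)) = t ((y \<otimes> x) \<otimes> r)"
      using that y by (simp add: A.m_assoc)
    also have "\<dots> = t (r \<otimes> (y \<otimes> x))"
      using that y by (intro t_comm) auto
    finally show "((x \<otimes> r) \<rightharpoonup>\<^bsub>dual_bimodule K A\<^esub> t) y =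
        ((x \<rightharpoonup>\<^bsub>dual_bimodule K A\<^esub> t) \<leftharpoonup>\<^bsub>dual_bimodule K A\<^esub> r) y"
      using that y by (simp add: A.m_assoc)
  qed (use that t in \<open>auto intro!: dual_action_closed\<close>)
  then have "(\<lambda>x. x \<rightharpoonup>\<^bsub>dual_bimodule K A\<^esub> t) \<in> bimodule_iso A (regular_bimodule A) (dual_bimodule K A)"
    using t bij D.add_lact D.lact_lact
    by (auto simp: bimodule_iso_def bimodule_hom_def regular_bimodule_def intro!: dual_action_closed)
  then show ?thesis
    unfolding symmetric_algebra_def using fin_dim_algebra_axioms by blast
qed

end

section \<open>The semitrivial extension\<close>

locale semitrivial = fin_dim_algebra K A
  for K :: "('k, 'c) ring_scheme" and A :: "('k, 'a, 'd) module_scheme" (structure) +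
  fixes \<psi> :: "(('a \<Rightarrow> 'k) \<times> ('a \<Rightarrow> 'k) \<Rightarrow>\<^sub>0 int) set \<Rightarrow> 'a"
  assumes psi_hom: "\<psi> \<in> bimodule_hom A (dual_tensor K A) (regular_bimodule A)"
    and psi_assoc:
      "\<lbrakk>f \<in> carrier (dual_bimodule K A); g \<in> carrier (dual_bimodule K A);
        h \<in> carrier (dual_bimodule K A)\<rbrakk> \<Longrightarrow>
      \<psi> (dual_pure_tensor K A f g) \<rightharpoonup>\<^bsub>dual_bimodule K A\<^esub> h =
      f \<leftharpoonup>\<^bsub>dual_bimodule K A\<^esub> \<psi> (dual_pure_tensor K A g h)"
begin

sublocale D: bimod A "dual_bimodule K A"
  by (rule dual_bimodule_bimod)

sublocale DD: bimod_pair A "dual_bimodule K A" "dual_bimodule K A" ..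

sublocale DV: module K "dual_space K A"
  by (rule dual_space_module)

text \<open>The balanced pairing that corresponds to \<open>\<psi>\<close> by the universal property
  of the tensor product. Once its laws are derived, cosets and free abelian groups no longer
  appear.\<close>

definition \<beta> :: "('a \<Rightarrow> 'k) \<Rightarrow> ('a \<Rightarrow> 'k) \<Rightarrow> 'a"
  where "\<beta> f g = \<psi> (dual_pure_tensor K A f g)"

lemma psi_simps:
  assumes "c \<in> carrier (dual_tensor K A)"
  shows "\<psi> c \<in> carrier A"
    and "c' \<in> carrier (dual_tensor K A) \<Longrightarrow> \<psi> (c \<oplus>\<^bsub>dual_tensor K A\<^esub> c') = \<psi> c \<oplus> \<psi> c'"
    and "r \<in> carrier A \<Longrightarrow> \<psi> (r \<rightharpoonup>\<^bsub>dual_tensor K A\<^esub> c) = r \<otimes> \<psi> c"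
    and "r \<in> carrier A \<Longrightarrow> \<psi> (c \<leftharpoonup>\<^bsub>dual_tensor K A\<^esub> r) = \<psi> c \<otimes> r"
  using psi_hom assms by (auto simp: bimodule_hom_def regular_bimodule_def)

context
  fixes f g
  assumes fg: "f \<in> carrier (dual_space K A)" "g \<in> carrier (dual_space K A)"
begin

lemma pure_closed: "dual_pure_tensor K A f g \<in> carrier (dual_tensor K A)"
  using fg by (intro DD.pure_tensor_closed) auto

lemma \<beta>_closed: "\<beta> f g \<in> carrier A"
  unfolding \<beta>_def by (rule psi_simps(1)[OF pure_closed])

lemma lact_\<beta>: "r \<in> carrier A \<Longrightarrow> r \<otimes> \<beta> f g = \<beta> (r \<rightharpoonup>\<^bsub>dual_bimodule K A\<^esub> f) g"
  using fg psi_simps(3)[OF pure_closed] by (simp add: \<beta>_def DD.lact_pure_tensor)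

lemma \<beta>_ract: "r \<in> carrier A \<Longrightarrow> \<beta> f g \<otimes> r = \<beta> f (g \<leftharpoonup>\<^bsub>dual_bimodule K A\<^esub> r)"
  using fg psi_simps(4)[OF pure_closed] by (simp add: \<beta>_def DD.pure_tensor_ract)

lemma \<beta>_balanced:
  "r \<in> carrier A \<Longrightarrow>
    \<beta> (f \<leftharpoonup>\<^bsub>dual_bimodule K A\<^esub> r) g = \<beta> f (r \<rightharpoonup>\<^bsub>dual_bimodule K A\<^esub> g)"
  using fg by (simp add: \<beta>_def DD.pure_tensor_balanced)

lemma \<beta>_assoc:
  "h \<in> carrier (dual_space K A) \<Longrightarrow>
    \<beta> f g \<rightharpoonup>\<^bsub>dual_bimodule K A\<^esub> h = f \<leftharpoonup>\<^bsub>dual_bimodule K A\<^esub> \<beta> g h"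
  using fg psi_assoc by (simp add: \<beta>_def)

end

lemma \<beta>_add:
  assumes "f \<in> carrier (dual_space K A)" "g \<in> carrier (dual_space K A)" "h \<in> carrier (dual_space K A)"
  shows "\<beta> (f \<oplus>\<^bsub>dual_space K A\<^esub> g) h = \<beta> f h \<oplus> \<beta> g h"
    and "\<beta> f (g \<oplus>\<^bsub>dual_space K A\<^esub> h) = \<beta> f g \<oplus> \<beta> f h"
  using assms DD.pure_tensor_add_left[of f g h] DD.pure_tensor_add_right[of f g h]
  by (simp_all add: \<beta>_def psi_simps(2) pure_closed)

text \<open>Scalars act on the dual through the multiples of the unit.\<close>

lemma \<beta>_smult:
  assumes "k \<in> carrier K" "f \<in> carrier (dual_space K A)" "g \<in> carrier (dual_space K A)"
  shows "\<beta> (k \<odot>\<^bsub>dual_space K A\<^esub> f) g = k \<odot> \<beta> f g"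
    and "\<beta> f (k \<odot>\<^bsub>dual_space K A\<^esub> g) = k \<odot> \<beta> f g"
proof -
  have "k \<odot>\<^bsub>dual_space K A\<^esub> f = (k \<odot> \<one>) \<rightharpoonup>\<^bsub>dual_bimodule K A\<^esub> f"
    using assms by (simp add: dual_action_smult D.one_lact)
  then show "\<beta> (k \<odot>\<^bsub>dual_space K A\<^esub> f) g = k \<odot> \<beta> f g"
    using assms lact_\<beta>[of f g "k \<odot> \<one>"] by (simp add: smult_mult_left \<beta>_closed)
  have "k \<odot>\<^bsub>dual_space K A\<^esub> g = g \<leftharpoonup>\<^bsub>dual_bimodule K A\<^esub> (k \<odot> \<one>)"
    using assms by (simp add: dual_action_smult D.one_ract)
  then show "\<beta> f (k \<odot>\<^bsub>dual_space K A\<^esub> g) = k \<odot> \<beta> f g"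
    using assms \<beta>_ract[of f g "k \<odot> \<one>"] by (simp add: smult_mult_right \<beta>_closed)
qed

section \<open>Algebra structure of the semitrivial extension\<close>

abbreviation S where "S \<equiv> semitrivial_extension K A \<psi>"

lemma semitrivial_simps [simp]:
  "carrier S = carrier A \<times> carrier (dual_space K A)"
  "(r, f) \<otimes>\<^bsub>S\<^esub> (s, g) =
    (r \<otimes> s \<oplus> \<beta> f g,
     (r \<rightharpoonup>\<^bsub>dual_bimodule K A\<^esub> g) \<oplus>\<^bsub>dual_space K A\<^esub> (f \<leftharpoonup>\<^bsub>dual_bimodule K A\<^esub> s))"
  "\<one>\<^bsub>S\<^esub> = (\<one>, \<zero>\<^bsub>dual_space K A\<^esub>)"
  "\<zero>\<^bsub>S\<^esub> = (\<zero>, \<zero>\<^bsub>dual_space K A\<^esub>)"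
  "(r, f) \<oplus>\<^bsub>S\<^esub> (s, g) = (r \<oplus> s, f \<oplus>\<^bsub>dual_space K A\<^esub> g)"
  "k \<odot>\<^bsub>S\<^esub> (r, f) = (k \<odot> r, k \<odot>\<^bsub>dual_space K A\<^esub> f)"
  by (simp_all add: semitrivial_extension_def \<beta>_def)

lemma semitrivial_vectorspace: "vectorspace K S"
proof (rule vs_criteria)
  show "\<forall>v\<in>carrier S. \<exists>w\<in>carrier S. v \<oplus>\<^bsub>S\<^esub> w = \<zero>\<^bsub>S\<^esub>"
  proof
    fix v assume "v \<in> carrier S"
    then obtain r f where v: "v = (r, f)" "r \<in> carrier A" "f \<in> carrier (dual_space K A)"
      by auto
    then show "\<exists>w\<in>carrier S. v \<oplus>\<^bsub>S\<^esub> w = \<zero>\<^bsub>S\<^esub>"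
      by (intro bexI[of _ "(\<ominus> r, \<ominus>\<^bsub>dual_space K A\<^esub> f)"]) (auto simp: M.r_neg DV.r_neg)
  qed
qed (auto simp: field_axioms M.a_ac DV.a_ac smult_assoc1 DV.smult_assoc1 smult_l_distr smult_r_distr
    DV.smult_l_distr DV.smult_r_distr)

text \<open>These facts mention the carrier and addition of \<open>dual_bimodule\<close>, which the
  simplifier rewrites to those of \<open>dual_space\<close>. They are cited with
  \<open>[simplified]\<close> to match that normal form.\<close>

lemmas dual_action_simps = D.lact_add D.ract_add D.add_lact D.add_ract D.lact_lact D.ract_ract
  D.lact_ract D.one_lact D.one_ract

text \<open>In the first component, bimodule linearity moves \<open>r\<close> and \<open>t\<close>
  inside \<open>\<beta>\<close>, and balancing moves \<open>s\<close> from \<open>f\<close> to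
  \<open>h\<close>. In the second, the bimodule laws match all terms except
  \<open>\<beta> f g \<rightharpoonup> h\<close> and \<open>f \<leftharpoonup> \<beta> g h\<close>,
  whose equality is the associativity hypothesis.\<close>

lemma semitrivial_mult_assoc:
  assumes "x \<in> carrier S" "y \<in> carrier S" "z \<in> carrier S"
  shows "(x \<otimes>\<^bsub>S\<^esub> y) \<otimes>\<^bsub>S\<^esub> z = x \<otimes>\<^bsub>S\<^esub> (y \<otimes>\<^bsub>S\<^esub> z)"
proof -
  obtain r f s g t h where xyz: "x = (r, f)" "y = (s, g)" "z = (t, h)"
    by (metis surj_pair)
  have rst: "r \<in> carrier A" "s \<in> carrier A" "t \<in> carrier A"
    and fgh: "f \<in> carrier (dual_space K A)" "g \<in> carrier (dual_space K A)" "h \<in> carrier (dual_space K A)"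
    using assms by (auto simp: xyz)
  have "(r \<otimes> s \<oplus> \<beta> f g) \<otimes> t \<oplus>
        \<beta> ((r \<rightharpoonup>\<^bsub>dual_bimodule K A\<^esub> g) \<oplus>\<^bsub>dual_space K A\<^esub> (f \<leftharpoonup>\<^bsub>dual_bimodule K A\<^esub> s)) h =
      r \<otimes> (s \<otimes> t \<oplus> \<beta> g h) \<oplus>
        \<beta> f ((s \<rightharpoonup>\<^bsub>dual_bimodule K A\<^esub> h) \<oplus>\<^bsub>dual_space K A\<^esub> (g \<leftharpoonup>\<^bsub>dual_bimodule K A\<^esub> t))"
    using rst fgh
    by (simp add: A.l_distr A.r_distr A.m_assoc M.a_ac \<beta>_add \<beta>_closed dual_action_closed lact_\<beta>
        \<beta>_ract \<beta>_balanced)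
  moreover have "((r \<otimes> s \<oplus> \<beta> f g) \<rightharpoonup>\<^bsub>dual_bimodule K A\<^esub> h) \<oplus>\<^bsub>dual_space K A\<^esub>
        (((r \<rightharpoonup>\<^bsub>dual_bimodule K A\<^esub> g) \<oplus>\<^bsub>dual_space K A\<^esub> (f \<leftharpoonup>\<^bsub>dual_bimodule K A\<^esub> s)) \<leftharpoonup>\<^bsub>dual_bimodule K A\<^esub> t) =
      (r \<rightharpoonup>\<^bsub>dual_bimodule K A\<^esub> ((s \<rightharpoonup>\<^bsub>dual_bimodule K A\<^esub> h) \<oplus>\<^bsub>dual_space K A\<^esub> (g \<leftharpoonup>\<^bsub>dual_bimodule K A\<^esub> t))) \<oplus>\<^bsub>dual_space K A\<^esub>
        (f \<leftharpoonup>\<^bsub>dual_bimodule K A\<^esub> (s \<otimes> t \<oplus> \<beta> g h))"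
    using rst fgh dual_action_simps[simplified]
    by (simp add: dual_action_closed \<beta>_closed \<beta>_assoc DV.a_ac)
  ultimately show ?thesis
    by (simp add: xyz)
qed

lemma semitrivial_ring: "ring S"
proof (rule ringI)
  interpret S: vectorspace K S
    by (rule semitrivial_vectorspace)
  show "abelian_group S"
    by (rule S.abelian_group_axioms)
  \<comment> \<open>The unit has second component zero, so \<open>\<beta>\<close> must vanish there
    for the unit laws. This is homogeneity of \<open>\<beta>\<close> at the scalar zero.\<close>
  have \<beta>_zero: "\<beta> \<zero>\<^bsub>dual_space K A\<^esub> f = \<zero>" "\<beta> f \<zero>\<^bsub>dual_space K A\<^esub> = \<zero>"
    if "f \<in> carrier (dual_space K A)" for f
    using that \<beta>_smult[of "\<zero>\<^bsub>K\<^esub>" "\<zero>\<^bsub>dual_space K A\<^esub>" f] \<beta>_smult[of "\<zero>\<^bsub>K\<^esub>" f "\<zero>\<^bsub>dual_space K A\<^esub>"]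
    by (simp_all add: \<beta>_closed)
  have act_zero: "r \<rightharpoonup>\<^bsub>dual_bimodule K A\<^esub> \<zero>\<^bsub>dual_space K A\<^esub> = \<zero>\<^bsub>dual_space K A\<^esub>"
    "\<zero>\<^bsub>dual_space K A\<^esub> \<leftharpoonup>\<^bsub>dual_bimodule K A\<^esub> r = \<zero>\<^bsub>dual_space K A\<^esub>"
    if "r \<in> carrier A" for r
    using that by (auto intro!: dual_space_ext dual_action_closed)
  show "Group.monoid S"
  proof (rule monoidI)
    show "x \<otimes>\<^bsub>S\<^esub> y \<in> carrier S" if "x \<in> carrier S" "y \<in> carrier S" for x y
      using that by (auto simp: \<beta>_closed dual_action_closed)
    show "\<one>\<^bsub>S\<^esub> \<in> carrier S"
      by simp
    show "\<one>\<^bsub>S\<^esub> \<otimes>\<^bsub>S\<^esub> x = x" if "x \<in> carrier S" for x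
      using that D.one_lact by (auto simp: \<beta>_zero act_zero)
    show "x \<otimes>\<^bsub>S\<^esub> \<one>\<^bsub>S\<^esub> = x" if "x \<in> carrier S" for x
      using that D.one_ract by (auto simp: \<beta>_zero act_zero)
  qed (rule semitrivial_mult_assoc)
  fix x y z assume xyz: "x \<in> carrier S" "y \<in> carrier S" "z \<in> carrier S"
  show "(x \<oplus>\<^bsub>S\<^esub> y) \<otimes>\<^bsub>S\<^esub> z = x \<otimes>\<^bsub>S\<^esub> z \<oplus>\<^bsub>S\<^esub> y \<otimes>\<^bsub>S\<^esub> z"
    using xyz dual_action_simps[simplified]
    by (auto simp: A.l_distr M.a_ac DV.a_ac \<beta>_add \<beta>_closed dual_action_closed)
  show "z \<otimes>\<^bsub>S\<^esub> (x \<oplus>\<^bsub>S\<^esub> y) = z \<otimes>\<^bsub>S\<^esub> x \<oplus>\<^bsub>S\<^esub> z \<otimes>\<^bsub>S\<^esub> y"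
    using xyz dual_action_simps[simplified]
    by (auto simp: A.r_distr M.a_ac DV.a_ac \<beta>_add \<beta>_closed dual_action_closed)
qed

text \<open>A finite generating set suffices for \<open>fin_dim\<close>. The vectors of a coordinate
  system span the first factor by reconstruction, and its functionals span the second by
  \<open>dual_expansion\<close>.\<close>

lemma semitrivial_fin_dim: "vectorspace.fin_dim K S"
proof -
  interpret S: vectorspace K S
    by (rule semitrivial_vectorspace)
  obtain B d where Bd: "coordinates B d"
    by (rule coordinates_exist[OF finite_dimensional])
  note B = coordinatesD(1-3)[OF Bd]
  define X where "X = (\<lambda>v. (v, \<zero>\<^bsub>dual_space K A\<^esub>)) ` B \<union> (\<lambda>v. (\<zero>, d v)) ` B"
  have X: "X \<subseteq> carrier S"
    using B by (auto simp: X_def)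
  then have span: "submodule K (S.span X) S"
    by (rule S.span_is_submodule)
  have inl: "mod_hom K A S (\<lambda>r. (r, \<zero>\<^bsub>dual_space K A\<^esub>))"
    by (intro mod_hom.intro mod_hom_axioms.intro module_axioms S.module_axioms)
      (auto simp: module_hom_def)
  have inr: "mod_hom K (dual_space K A) S (\<lambda>f. (\<zero>, f))"
    by (intro mod_hom.intro mod_hom_axioms.intro DV.module_axioms S.module_axioms)
      (auto simp: module_hom_def)
  \<comment> \<open>The default value zero of a sum over an infinite set also lies in the span, so
    \<open>I\<close> may be arbitrary.\<close>
  have sum: "(\<Oplus>\<^bsub>S\<^esub>v\<in>I. c v) \<in> S.span X" if "\<And>v. v \<in> I \<Longrightarrow> c v \<in> S.span X" for c and I :: "'a set"
    using that
  proof (induction I rule: infinite_finite_induct)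
    case (insert i I)
    moreover have "c \<in> insert i I \<rightarrow> carrier S"
      using insert.prems S.span_closed[OF X] by auto
    ultimately show ?case
      using submodule.m_closed[OF span] by (simp add: Pi_iff)
  qed (use submodule.zero_closed[OF span] in auto)
  have "(r, f) \<in> S.span X" if r: "r \<in> carrier A" and f: "f \<in> carrier (dual_space K A)" for r f
  proof -
    interpret inl: mod_hom K A S "\<lambda>r. (r, \<zero>\<^bsub>dual_space K A\<^esub>)"
      by (rule inl)
    interpret inr: mod_hom K "dual_space K A" S "\<lambda>f. (\<zero>, f)"
      by (rule inr)
    have dr: "d v r \<in> carrier K" and fv: "f v \<in> carrier K" if "v \<in> B" for v
      using that B dual_closed[OF _ r] dual_closed[OF f] by (simp_all add: Pi_iff subset_iff)
    have gen: "x \<in> S.span X" if "x \<in> X" for x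
      using that S.in_own_span[OF X] by blast
    have "(\<lambda>v. d v r \<odot> v) \<in> B \<rightarrow> carrier A"
      using B(2) dr by auto
    then have "(r, \<zero>\<^bsub>dual_space K A\<^esub>) = (\<Oplus>\<^bsub>S\<^esub>v\<in>B. (d v r \<odot> v, \<zero>\<^bsub>dual_space K A\<^esub>))"
      by (subst coordinatesD(4)[OF Bd r, symmetric]) (rule inl.hom_finsum)
    also have "\<dots> \<in> S.span X"
    proof (rule sum)
      fix v assume v: "v \<in> B"
      then have "d v r \<odot>\<^bsub>S\<^esub> (v, \<zero>\<^bsub>dual_space K A\<^esub>) \<in> S.span X"
        by (intro submodule.smult_closed[OF span] dr gen) (auto simp: X_def)
      then show "(d v r \<odot> v, \<zero>\<^bsub>dual_space K A\<^esub>) \<in> S.span X"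
        using dr[OF v] by simp
    qed
    finally have 1: "(r, \<zero>\<^bsub>dual_space K A\<^esub>) \<in> S.span X" .
    have "(\<lambda>v. f v \<odot>\<^bsub>dual_space K A\<^esub> d v) \<in> B \<rightarrow> carrier (dual_space K A)"
      using B(3) fv by auto
    \<comment> \<open>The expansion of \<open>f\<close> has \<open>f\<close> on both sides. It is
      folded from right to left, because substituting it for \<open>f\<close> would also hit the
      coefficients \<open>f v\<close>.\<close>
    from inr.hom_finsum[OF this]
    have "(\<zero>, f) = (\<Oplus>\<^bsub>S\<^esub>v\<in>B. (\<zero>, f v \<odot>\<^bsub>dual_space K A\<^esub> d v))"
      unfolding dual_expansion[OF Bd f, symmetric] .
    also have "\<dots> \<in> S.span X"
    proof (rule sum)
      fix v assume v: "v \<in> B"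
      then have "f v \<odot>\<^bsub>S\<^esub> (\<zero>, d v) \<in> S.span X"
        by (intro submodule.smult_closed[OF span] fv gen) (auto simp: X_def)
      then show "(\<zero>, f v \<odot>\<^bsub>dual_space K A\<^esub> d v) \<in> S.span X"
        using fv[OF v] by simp
    qed
    finally have 2: "(\<zero>, f) \<in> S.span X" .
    show ?thesis
      using submodule.m_closed[OF span 1 2] r f by simp
  qed
  then have "S.gen_set X"
    using S.span_closed[OF X] by auto
  then show ?thesis
    unfolding S.fin_dim_def using X B(1) by (intro exI[of _ X]) (simp add: X_def)
qed

lemma semitrivial_fin_dim_algebra: "fin_dim_algebra K S"
proof -
  have "fin_dim_algebra_axioms K S"
  proof
    fix k x y assume kxy: "k \<in> carrier K" "x \<in> carrier S" "y \<in> carrier S"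
    then show "(k \<odot>\<^bsub>S\<^esub> x) \<otimes>\<^bsub>S\<^esub> y = k \<odot>\<^bsub>S\<^esub> (x \<otimes>\<^bsub>S\<^esub> y)"
      by (auto simp: smult_mult_left smult_r_distr DV.smult_r_distr \<beta>_smult dual_action_smult
          \<beta>_closed dual_action_closed)
    show "x \<otimes>\<^bsub>S\<^esub> (k \<odot>\<^bsub>S\<^esub> y) = k \<odot>\<^bsub>S\<^esub> (x \<otimes>\<^bsub>S\<^esub> y)"
      using kxy by (auto simp: smult_mult_right smult_r_distr DV.smult_r_distr \<beta>_smult
          dual_action_smult \<beta>_closed dual_action_closed)
  qed (rule semitrivial_fin_dim)
  then show ?thesis
    by (intro fin_dim_algebra.intro semitrivial_vectorspace semitrivial_ring)
qed

lemma semitrivial_symmetric: "symmetric_algebra K S"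
proof -
  interpret S: fin_dim_algebra K S
    by (rule semitrivial_fin_dim_algebra)
  define t where "t = (\<lambda>x\<in>carrier S. snd x \<one>)"
  have t: "t \<in> carrier (dual_space K S)"
    by (auto simp: S.in_dual_space_iff t_def dual_closed)
  \<comment> \<open>At the unit, \<open>r \<rightharpoonup> g\<close> takes the value
    \<open>g (\<one> \<otimes> r)\<close> and \<open>f \<leftharpoonup> s\<close> the value
    \<open>f (s \<otimes> \<one>)\<close>.\<close>
  have t_mult: "t ((r, f) \<otimes>\<^bsub>S\<^esub> (s, g)) = g r \<oplus>\<^bsub>K\<^esub> f s"
    if "(r, f) \<in> carrier S" "(s, g) \<in> carrier S" for r f s g
    using that by (simp add: t_def \<beta>_closed dual_action_closed)
  \<comment> \<open>A functional on a product is determined by its restrictions to the factors. This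
    equivalence splits injectivity and surjectivity into independent questions about
    \<open>g\<close> and about \<open>s\<close>.\<close>
  have image: "(s, g) \<rightharpoonup>\<^bsub>dual_bimodule K S\<^esub> t = F \<longleftrightarrow>
      (\<forall>r\<in>carrier A. F (r, \<zero>\<^bsub>dual_space K A\<^esub>) = g r) \<and>
      (\<forall>f\<in>carrier (dual_space K A). F (\<zero>, f) = f s)"
    if sg: "(s, g) \<in> carrier S" and F: "F \<in> carrier (dual_space K S)" for s g F
  proof -
    have zero: "f \<zero> = \<zero>\<^bsub>K\<^esub>" if "f \<in> carrier (dual_space K A)" for f
      using mod_hom.f0_is_0[OF dual_mod_hom[OF that]] by simp
    have F_split: "F (r, f) = F (r, \<zero>\<^bsub>dual_space K A\<^esub>) \<oplus>\<^bsub>K\<^esub> F (\<zero>, f)"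
      if "r \<in> carrier A" "f \<in> carrier (dual_space K A)" for r f
      using S.dual_add[OF F, of "(r, \<zero>\<^bsub>dual_space K A\<^esub>)" "(\<zero>, f)"] that by simp
    have act: "((s, g) \<rightharpoonup>\<^bsub>dual_bimodule K S\<^esub> t) (r, f) = g r \<oplus>\<^bsub>K\<^esub> f s"
      if "r \<in> carrier A" "f \<in> carrier (dual_space K A)" for r f
      using that sg t_mult[of r f s g] S.dual_bimodule_apply(1)[of "(r, f)" "(s, g)" t] by simp
    show ?thesis
    proof
      assume eq: "(s, g) \<rightharpoonup>\<^bsub>dual_bimodule K S\<^esub> t = F"
      show "(\<forall>r\<in>carrier A. F (r, \<zero>\<^bsub>dual_space K A\<^esub>) = g r) \<and>
          (\<forall>f\<in>carrier (dual_space K A). F (\<zero>, f) = f s)"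
      proof (intro conjI ballI)
        show "F (r, \<zero>\<^bsub>dual_space K A\<^esub>) = g r" if "r \<in> carrier A" for r
          using act[OF that, of "\<zero>\<^bsub>dual_space K A\<^esub>"] sg that dual_closed[of g r] by (simp add: eq)
        show "F (\<zero>, f) = f s" if "f \<in> carrier (dual_space K A)" for f
          using act[OF _ that, of \<zero>] sg dual_closed[OF that, of s] zero[of g] by (simp add: eq)
      qed
    next
      assume "(\<forall>r\<in>carrier A. F (r, \<zero>\<^bsub>dual_space K A\<^esub>) = g r) \<and>
          (\<forall>f\<in>carrier (dual_space K A). F (\<zero>, f) = f s)"
      then have "((s, g) \<rightharpoonup>\<^bsub>dual_bimodule K S\<^esub> t) (r, f) = F (r, f)"
        if "r \<in> carrier A" "f \<in> carrier (dual_space K A)" for r f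
        using that by (simp only: act[OF that] F_split[OF that])
      then show "(s, g) \<rightharpoonup>\<^bsub>dual_bimodule K S\<^esub> t = F"
        using sg by (intro S.dual_space_ext[OF S.dual_action_closed(1)] t F) auto
    qed
  qed
  have "bij_betw (\<lambda>x. x \<rightharpoonup>\<^bsub>dual_bimodule K S\<^esub> t) (carrier S) (carrier (dual_space K S))"
  proof (rule bij_betw_imageI)
    show "inj_on (\<lambda>x. x \<rightharpoonup>\<^bsub>dual_bimodule K S\<^esub> t) (carrier S)"
    proof (rule inj_onI)
      fix x y assume xy: "x \<in> carrier S" "y \<in> carrier S"
        and eq: "x \<rightharpoonup>\<^bsub>dual_bimodule K S\<^esub> t = y \<rightharpoonup>\<^bsub>dual_bimodule K S\<^esub> t"
      obtain s g s' g' where [simp]: "x = (s, g)" "y = (s', g')"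
        by (metis surj_pair)
      have closed: "s \<in> carrier A" "s' \<in> carrier A" "g \<in> carrier (dual_space K A)" "g' \<in> carrier (dual_space K A)"
        using xy by auto
      \<comment> \<open>Naming the common image lets two instances of \<open>image\<close> read both
        pairs off the same functional.\<close>
      define F where "F = y \<rightharpoonup>\<^bsub>dual_bimodule K S\<^esub> t"
      have F: "F \<in> carrier (dual_space K S)"
        unfolding F_def using xy t by (intro S.dual_action_closed)
      have "F (r, \<zero>\<^bsub>dual_space K A\<^esub>) = g r" "F (r, \<zero>\<^bsub>dual_space K A\<^esub>) = g' r" if "r \<in> carrier A" for r
        using image[of s g F] image[of s' g' F] xy F eq that by (simp_all add: F_def)
      then have "g = g'"
        using closed by (intro dual_space_ext) auto
      moreover have "s = s'"
      proof (rule dual_separates[OF finite_dimensional closed(1,2)])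
        fix f assume "f \<in> carrier (dual_space K A)"
        then have "F (\<zero>, f) = f s" "F (\<zero>, f) = f s'"
          using image[of s g F] image[of s' g' F] xy F eq by (simp_all add: F_def)
        then show "f s = f s'"
          by simp
      qed
      ultimately show "x = y"
        by simp
    qed
    show "(\<lambda>x. x \<rightharpoonup>\<^bsub>dual_bimodule K S\<^esub> t) ` carrier S = carrier (dual_space K S)"
    proof (intro equalityI subsetI)
      fix F assume F: "F \<in> carrier (dual_space K S)"
      \<comment> \<open>The restriction of \<open>F\<close> to the first factor, cut off outside the
        carrier so as to be extensional.\<close>
      define g where "g = (\<lambda>r\<in>carrier A. F (r, \<zero>\<^bsub>dual_space K A\<^esub>))"
      have g: "g \<in> carrier (dual_space K A)"
        using S.dual_add[OF F, of "(x, \<zero>\<^bsub>dual_space K A\<^esub>)" "(y, \<zero>\<^bsub>dual_space K A\<^esub>)" for x y]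
          S.dual_smult[OF F, of k "(x, \<zero>\<^bsub>dual_space K A\<^esub>)" for k x]
        by (auto simp: in_dual_space_iff g_def intro!: S.dual_closed[OF F])
      have "mod_hom K (dual_space K A) (self_module K) (\<lambda>f. F (\<zero>, f))"
        using S.dual_add[OF F, of "(\<zero>, f)" "(\<zero>, f')" for f f'] S.dual_smult[OF F, of k "(\<zero>, f)" for k f]
        by (intro mod_hom.intro mod_hom_axioms.intro DV.module_axioms self_module_module)
          (auto simp: module_hom_def intro!: S.dual_closed[OF F])
      then obtain s where s: "s \<in> carrier A"
        "\<And>f. f \<in> carrier (dual_space K A) \<Longrightarrow> F (\<zero>, f) = f s"
        using dual_reflexive[OF finite_dimensional] by blast
      have "(s, g) \<rightharpoonup>\<^bsub>dual_bimodule K S\<^esub> t = F"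
        using image[of s g F] s g F by (simp add: g_def)
      then show "F \<in> (\<lambda>x. x \<rightharpoonup>\<^bsub>dual_bimodule K S\<^esub> t) ` carrier S"
        using s(1) g by (intro image_eqI[of _ _ "(s, g)"]) auto
    next
      fix F assume "F \<in> (\<lambda>x. x \<rightharpoonup>\<^bsub>dual_bimodule K S\<^esub> t) ` carrier S"
      then show "F \<in> carrier (dual_space K S)"
        using t by (auto simp del: semitrivial_simps intro!: S.dual_action_closed)
    qed
  qed
  moreover have "t (x \<otimes>\<^bsub>S\<^esub> y) = t (y \<otimes>\<^bsub>S\<^esub> x)" if "x \<in> carrier S" "y \<in> carrier S" for x y
  proof -
    obtain r f s g where "x = (r, f)" "y = (s, g)"
      by (metis surj_pair)
    \<comment> \<open>The product stays folded so that \<open>t_mult\<close> applies; the symmetry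
      is then commutativity of addition in \<open>K\<close>.\<close>
    then show ?thesis
      using that t_mult[of r f s g] t_mult[of s g r f]
      by (auto simp: dual_closed R.a_comm simp del: semitrivial_simps(2))
  qed
  ultimately show ?thesis
    using t by (intro S.symmetric_algebraI)
qed

end

theorem propositionA:
  fixes K :: "('k, 'c) ring_scheme"
    and R :: "('k, 'a, 'd) module_scheme"
    and \<psi> :: "(('a \<Rightarrow> 'k) \<times> ('a \<Rightarrow> 'k) \<Rightarrow>\<^sub>0 int) set \<Rightarrow> 'a"
  assumes "fin_dim_algebra K R"
    and "\<psi> \<in> bimodule_hom R (dual_tensor K R) (regular_bimodule R)"
    and "\<And>f g h. \<lbrakk>f \<in> carrier (dual_bimodule K R); g \<in> carrier (dual_bimodule K R);
                  h \<in> carrier (dual_bimodule K R)\<rbrakk> \<Longrightarrow>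
      \<psi> (dual_pure_tensor K R f g) \<rightharpoonup>\<^bsub>dual_bimodule K R\<^esub> h =
      f \<leftharpoonup>\<^bsub>dual_bimodule K R\<^esub> \<psi> (dual_pure_tensor K R g h)"
  shows "symmetric_algebra K (semitrivial_extension K R \<psi>)"
proof -
  interpret semitrivial K R \<psi>
    by (intro semitrivial.intro semitrivial_axioms.intro assms)
  show ?thesis
    by (rule semitrivial_symmetric)
qed

end
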